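(* Let $\mathfrak{g}$ be a (finite-dimensional, real) unimodular Lie algebra with Killing form zero, and let $h$ be any metric on $\mathfrak{g}$. Then the Ricci tensor of $h$ is given by \[\operatorname{Ric}(v,w)=\tfrac12\, h(dv^\flat,dw^\flat)-\tfrac12\,h(\operatorname{ad}(v),\operatorname{ad}(w)),\qquad v,w\in\mathfrak{g},\] where $h$ also denotes the induced scalar products on $\Lambda^2\mathfrak{g}^*$ and on $\operatorname{End}(\mathfrak{g})\cong\mathfrak{g}^*\otimes\mathfrak{g}$.
   Context: A metric on a real Lie algebra $\mathfrak{g}$ is a non-degenerate symmetric bilinear form $h$ on $\mathfrak{g}$ of arbitrary signature, identified with the left-invariant pseudoriemannian metric it defines on a Lie group with Lie algebra $\mathfrak{g}$; $\operatorname{Ric}$ is the Ricci tensor of that left-invariant metric, a bilinear form on $\mathfrak{g}$, with the usual sign convention. $\mathfrak{g}$ is unimodular if $\operatorname{tr}\operatorname{ad}(v)=0$ for all $v$. $v^\flat=h(v,\cdot)\in\mathfrak{g}^*$, and $d\colon\mathfrak{g}^*\to\Lambda^2\mathfrak{g}^*$ is $d\alpha(x,y)=-\alpha([x,y])$. If $\{e_i\}$ is an orthonormal basis, $h(e_i,e_i)=\epsilon_i=\pm1$, with dual basis $\{e^i\}$, the induced scalar product on $\Lambda^2\mathfrak{g}^*$ is the one for which the $e^i\wedge e^j$, $i<j$, are orthogonal with norm $\epsilon_i\epsilon_j$, and the one on $\mathfrak{g}^*\otimes\mathfrak{g}$ is the one for which the $e^i\otimes e_j$ are orthogonal with norm $\epsilon_i\epsilon_j$.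 *)

theory Defs
  imports "HOL-Analysis.Analysis"
begin

text \<open>
  A finite-dimensional real vector space is a type of class \<^class>\<open>real_vector\<close> satisfying
  \<open>finite_dim\<close> below; unlike \<^class>\<open>euclidean_space\<close> this carries no preferred inner product
  and includes dimension zero.
\<close>

definition finite_dim :: "'g::real_vector itself \<Rightarrow> bool" where
  "finite_dim _ \<longleftrightarrow> (\<exists>B::'g set. finite B \<and> span B = UNIV)"

definition basis_list :: "'g::real_vector list \<Rightarrow> bool" where
  "basis_list es \<longleftrightarrow> distinct es \<and> independent (set es) \<and> span (set es) = UNIV"

definition dual_basis :: "'g::real_vector list \<Rightarrow> nat \<Rightarrow> 'g \<Rightarrow> real" where
  "dual_basis es i x = representation (set es) x (es ! i)"

text \<open>
  The trace is computed in an arbitrary basis, whose choice is irrelevant by \<open>lin_trace_eq\<close>;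
  \<^term>\<open>dual_basis es i (f (es ! i))\<close> is the \<open>i\<close>-th diagonal entry of the matrix of \<open>f\<close>.
\<close>

definition lin_trace :: "('g::real_vector \<Rightarrow> 'g) \<Rightarrow> real" where
  "lin_trace f =
    (let es = (SOME es. basis_list es) in \<Sum>i<length es. dual_basis es i (f (es ! i)))"


section \<open>Lie algebras\<close>

definition lie_bracket :: "('g::real_vector \<Rightarrow> 'g \<Rightarrow> 'g) \<Rightarrow> bool" where
  "lie_bracket br \<longleftrightarrow> bilinear br \<and> (\<forall>x. br x x = 0) \<and>
    (\<forall>x y z. br x (br y z) + br y (br z x) + br z (br x y) = 0)"

definition ad :: "('g \<Rightarrow> 'g \<Rightarrow> 'g) \<Rightarrow> 'g \<Rightarrow> 'g \<Rightarrow> 'g" where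
  "ad br v = (\<lambda>w. br v w)"

definition unimodular :: "('g::real_vector \<Rightarrow> 'g \<Rightarrow> 'g) \<Rightarrow> bool" where
  "unimodular br \<longleftrightarrow> (\<forall>v. lin_trace (ad br v) = 0)"

definition killing_form :: "('g::real_vector \<Rightarrow> 'g \<Rightarrow> 'g) \<Rightarrow> 'g \<Rightarrow> 'g \<Rightarrow> real" where
  "killing_form br v w = lin_trace (ad br v \<circ> ad br w)"

definition ce_differential :: "('g \<Rightarrow> 'g \<Rightarrow> 'g) \<Rightarrow> ('g \<Rightarrow> real) \<Rightarrow> 'g \<Rightarrow> 'g \<Rightarrow> real" where
  "ce_differential br \<alpha> x y = - \<alpha> (br x y)"


section \<open>Metrics and the Ricci tensor\<close>

definition is_metric :: "('g::real_vector \<Rightarrow> 'g \<Rightarrow> real) \<Rightarrow> bool" where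
  "is_metric h \<longleftrightarrow> bilinear h \<and> (\<forall>x y. h x y = h y x) \<and>
    (\<forall>x. (\<forall>y. h x y = 0) \<longrightarrow> x = 0)"

definition flat :: "('g \<Rightarrow> 'g \<Rightarrow> real) \<Rightarrow> 'g \<Rightarrow> 'g \<Rightarrow> real" where
  "flat h v = (\<lambda>x. h v x)"

text \<open>
  Identify \<open>\<gg>\<close> with the left-invariant vector fields. The Levi-Civita connection of a
  left-invariant metric is left-invariant, so it is a bilinear map \<open>D x y = \<nabla>\<^sub>x y\<close> on \<open>\<gg>\<close>.
  Metric compatibility has no term \<open>x (h y z)\<close> because \<open>h y z\<close> is constant
  for left-invariant \<open>y\<close> and \<open>z\<close>.
\<close>

definition is_levi_civita ::
  "('g::real_vector \<Rightarrow> 'g \<Rightarrow> 'g) \<Rightarrow> ('g \<Rightarrow> 'g \<Rightarrow> real) \<Rightarrow> ('g \<Rightarrow> 'g \<Rightarrow> 'g) \<Rightarrow> bool" where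
  "is_levi_civita br h D \<longleftrightarrow> bilinear D \<and>
    (\<forall>x y. D x y - D y x = br x y) \<and>
    (\<forall>x y z. h (D x y) z + h y (D x z) = 0)"

definition levi_civita ::
  "('g::real_vector \<Rightarrow> 'g \<Rightarrow> 'g) \<Rightarrow> ('g \<Rightarrow> 'g \<Rightarrow> real) \<Rightarrow> 'g \<Rightarrow> 'g \<Rightarrow> 'g" where
  "levi_civita br h = (THE D. is_levi_civita br h D)"

definition curvature ::
  "('g::real_vector \<Rightarrow> 'g \<Rightarrow> 'g) \<Rightarrow> ('g \<Rightarrow> 'g \<Rightarrow> real) \<Rightarrow> 'g \<Rightarrow> 'g \<Rightarrow> 'g \<Rightarrow> 'g" where
  "curvature br h x y z = (let D = levi_civita br h in
    D x (D y z) - D y (D x z) - D (br x y) z)"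

text \<open>With this sign the Ricci tensor of a round sphere is positive.\<close>

definition Ric ::
  "('g::real_vector \<Rightarrow> 'g \<Rightarrow> 'g) \<Rightarrow> ('g \<Rightarrow> 'g \<Rightarrow> real) \<Rightarrow> 'g \<Rightarrow> 'g \<Rightarrow> real" where
  "Ric br h v w = lin_trace (\<lambda>x. curvature br h x v w)"


section \<open>Induced scalar products\<close>

definition orthonormal_basis :: "('g::real_vector \<Rightarrow> 'g \<Rightarrow> real) \<Rightarrow> 'g list \<Rightarrow> bool" where
  "orthonormal_basis h es \<longleftrightarrow> basis_list es \<and>
    (\<forall>i<length es. h (es ! i) (es ! i) \<in> {1, - 1}) \<and>
    (\<forall>i<length es. \<forall>j<length es. i \<noteq> j \<longrightarrow> h (es ! i) (es ! j) = 0)"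

text \<open>
  Elements of \<open>\<Lambda>\<^sup>2\<gg>\<^sup>*\<close> are alternating bilinear forms, with
  \<open>\<alpha> \<and> \<beta> = \<alpha> \<otimes> \<beta> - \<beta> \<otimes> \<alpha>\<close>, so the coefficient of such a form \<open>\<omega>\<close> along
  \<open>e\<^sup>i \<and> e\<^sup>j\<close>, \<open>i < j\<close>, is \<open>\<omega> (e\<^sub>i, e\<^sub>j)\<close>. The coefficient of an endomorphism \<open>A\<close> along
  \<open>e\<^sup>i \<otimes> e\<^sub>j\<close> is \<open>e\<^sup>j (A e\<^sub>i)\<close>. The lemmas below show that the sums have the prescribed
  values on \<open>e\<^sup>i \<and> e\<^sup>j\<close> and \<open>e\<^sup>i \<otimes> e\<^sub>j\<close>, and do not depend on the orthonormal basis.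
\<close>

definition lambda2_prod_wrt :: "'g::real_vector list \<Rightarrow> ('g \<Rightarrow> 'g \<Rightarrow> real) \<Rightarrow>
    ('g \<Rightarrow> 'g \<Rightarrow> real) \<Rightarrow> ('g \<Rightarrow> 'g \<Rightarrow> real) \<Rightarrow> real" where
  "lambda2_prod_wrt es h \<alpha> \<beta> = (\<Sum>j<length es. \<Sum>i<j.
    h (es ! i) (es ! i) * h (es ! j) (es ! j) * \<alpha> (es ! i) (es ! j) * \<beta> (es ! i) (es ! j))"

definition end_prod_wrt :: "'g::real_vector list \<Rightarrow> ('g \<Rightarrow> 'g \<Rightarrow> real) \<Rightarrow>
    ('g \<Rightarrow> 'g) \<Rightarrow> ('g \<Rightarrow> 'g) \<Rightarrow> real" where
  "end_prod_wrt es h A B = (\<Sum>i<length es. \<Sum>j<length es.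
    h (es ! i) (es ! i) * h (es ! j) (es ! j) *
    dual_basis es j (A (es ! i)) * dual_basis es j (B (es ! i)))"

definition lambda2_prod :: "('g::real_vector \<Rightarrow> 'g \<Rightarrow> real) \<Rightarrow>
    ('g \<Rightarrow> 'g \<Rightarrow> real) \<Rightarrow> ('g \<Rightarrow> 'g \<Rightarrow> real) \<Rightarrow> real" where
  "lambda2_prod h = lambda2_prod_wrt (SOME es. orthonormal_basis h es) h"

definition end_prod :: "('g::real_vector \<Rightarrow> 'g \<Rightarrow> real) \<Rightarrow>
    ('g \<Rightarrow> 'g) \<Rightarrow> ('g \<Rightarrow> 'g) \<Rightarrow> real" where
  "end_prod h = end_prod_wrt (SOME es. orthonormal_basis h es) h"

definition wedge :: "('g \<Rightarrow> real) \<Rightarrow> ('g \<Rightarrow> real) \<Rightarrow> 'g \<Rightarrow> 'g \<Rightarrow> real" where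
  "wedge \<alpha> \<beta> x y = \<alpha> x * \<beta> y - \<beta> x * \<alpha> y"

lemma dual_basis_nth:
  assumes "basis_list es" "i < length es" "j < length es"
  shows "dual_basis es i (es ! j) = (if i = j then 1 else 0)"
  using assms by (auto simp: dual_basis_def basis_list_def representation_basis nth_eq_iff_index_eq)

lemma lambda2_prod_wrt_wedge:
  assumes "basis_list es" "i < j" "j < length es" "k < l" "l < length es"
  shows "lambda2_prod_wrt es h (wedge (dual_basis es i) (dual_basis es j))
      (wedge (dual_basis es k) (dual_basis es l)) =
    (if i = k \<and> j = l then h (es ! i) (es ! i) * h (es ! j) (es ! j) else 0)"
proof -
  have w: "wedge (dual_basis es p) (dual_basis es q) (es ! a) (es ! b) =
      (if p = a \<and> q = b then 1 else 0)"
    if "p < q" "q < length es" "a < b" "b < length es" for p q a b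
    using that assms(1) by (auto simp: wedge_def dual_basis_nth)
  have "lambda2_prod_wrt es h (wedge (dual_basis es i) (dual_basis es j))
      (wedge (dual_basis es k) (dual_basis es l)) =
    (\<Sum>b<length es. \<Sum>a<b. if b = j then (if a = i then
      (if i = k \<and> j = l then h (es ! i) (es ! i) * h (es ! j) (es ! j) else 0) else 0) else 0)"
    unfolding lambda2_prod_wrt_def using assms by (intro sum.cong refl) (auto simp: w)
  also have "\<dots> = (\<Sum>b<length es. if b = j then
      (if i = k \<and> j = l then h (es ! i) (es ! i) * h (es ! j) (es ! j) else 0) else 0)"
    using assms by (intro sum.cong refl) (auto simp: sum.delta)
  also have "\<dots> = (if i = k \<and> j = l then h (es ! i) (es ! i) * h (es ! j) (es ! j) else 0)"
    using assms by (simp add: sum.delta)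
  finally show ?thesis .
qed

lemma end_prod_wrt_tensor:
  assumes "basis_list es" "i < length es" "j < length es" "k < length es" "l < length es"
  shows "end_prod_wrt es h (\<lambda>x. dual_basis es i x *\<^sub>R es ! j) (\<lambda>x. dual_basis es k x *\<^sub>R es ! l) =
    (if i = k \<and> j = l then h (es ! i) (es ! i) * h (es ! j) (es ! j) else 0)"
proof -
  have t: "dual_basis es b (dual_basis es p (es ! a) *\<^sub>R es ! q) =
      (if p = a \<and> q = b then 1 else 0)"
    if "p < length es" "q < length es" "a < length es" "b < length es" for p q a b
  proof -
    have "dual_basis es b (c *\<^sub>R x) = c * dual_basis es b x" for c x
      using assms(1) by (simp add: dual_basis_def basis_list_def representation_scale)
    then show ?thesis using that assms(1) by (auto simp: dual_basis_nth)
  qed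
  have "end_prod_wrt es h (\<lambda>x. dual_basis es i x *\<^sub>R es ! j) (\<lambda>x. dual_basis es k x *\<^sub>R es ! l) =
    (\<Sum>a<length es. \<Sum>b<length es. if b = j then (if a = i then
      (if i = k \<and> j = l then h (es ! i) (es ! i) * h (es ! j) (es ! j) else 0) else 0) else 0)"
    unfolding end_prod_wrt_def using assms by (intro sum.cong refl) (auto simp: t)
  also have "\<dots> = (if i = k \<and> j = l then h (es ! i) (es ! i) * h (es ! j) (es ! j) else 0)"
    using assms by (simp add: sum.delta)
  finally show ?thesis .
qed

lemma basis_expansion:
  assumes b: "basis_list es"
  shows "(\<Sum>i<length es. dual_basis es i x *\<^sub>R es ! i) = x"
proof -
  have "(\<Sum>e\<in>set es. representation (set es) x e *\<^sub>R e) = x"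
    using b by (intro real_vector.sum_representation_eq) (auto simp: basis_list_def)
  moreover have "bij_betw ((!) es) {..<length es} (set es)"
    using b by (intro bij_betw_nth) (auto simp: basis_list_def)
  ultimately show ?thesis
    unfolding dual_basis_def
    by (subst (asm) sum.reindex_bij_betw[symmetric]) assumption+
qed

lemma linear_dual_basis: "basis_list es \<Longrightarrow> linear (dual_basis es i)"
  by (auto intro!: linearI
      simp: dual_basis_def basis_list_def representation_add representation_scale)

lemma lin_trace_eq:
  assumes f: "linear f" and es: "basis_list es"
  shows "lin_trace f = (\<Sum>i<length es. dual_basis es i (f (es ! i)))"
proof -
  define fs :: "'a list" where "fs = (SOME fs. basis_list fs)"
  have fs: "basis_list fs" unfolding fs_def using es by (rule someI)
  have "(\<Sum>i<length es. dual_basis es i (f (es ! i))) =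
    (\<Sum>i<length es. \<Sum>k<length fs. dual_basis fs k (f (es ! i)) * dual_basis es i (fs ! k))"
  proof (intro sum.cong refl)
    fix i
    show "dual_basis es i (f (es ! i)) =
        (\<Sum>k<length fs. dual_basis fs k (f (es ! i)) * dual_basis es i (fs ! k))"
      by (subst (1) basis_expansion[OF fs, symmetric, of "f (es ! i)"])
        (simp add: linear_sum[OF linear_dual_basis[OF es]] linear_cmul[OF linear_dual_basis[OF es]])
  qed
  also have "\<dots> = (\<Sum>k<length fs. \<Sum>i<length es.
      dual_basis es i (fs ! k) * dual_basis fs k (f (es ! i)))"
    by (subst sum.swap) (simp add: mult.commute)
  also have "\<dots> = (\<Sum>k<length fs. dual_basis fs k (f (fs ! k)))"
  proof (intro sum.cong refl)
    fix k
    have "dual_basis fs k (f (\<Sum>i<length es. dual_basis es i (fs ! k) *\<^sub>R es ! i)) =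
        (\<Sum>i<length es. dual_basis es i (fs ! k) * dual_basis fs k (f (es ! i)))"
      by (simp add: linear_sum[OF f] linear_cmul[OF f]
          linear_sum[OF linear_dual_basis[OF fs]] linear_cmul[OF linear_dual_basis[OF fs]])
    then show "(\<Sum>i<length es. dual_basis es i (fs ! k) * dual_basis fs k (f (es ! i))) =
        dual_basis fs k (f (fs ! k))"
      by (simp add: basis_expansion[OF es])
  qed
  finally show ?thesis by (simp add: lin_trace_def fs_def Let_def)
qed

lemma dual_basis_orthonormal:
  assumes h: "is_metric h" and es: "orthonormal_basis h es" and i: "i < length es"
  shows "dual_basis es i x = h (es ! i) (es ! i) * h x (es ! i)"
proof -
  have b: "basis_list es" using es by (simp add: orthonormal_basis_def)
  have lin: "linear (\<lambda>x. h x y)" for y using h by (auto simp: is_metric_def bilinear_def)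
  have "h x (es ! i) = h (\<Sum>j<length es. dual_basis es j x *\<^sub>R es ! j) (es ! i)"
    by (simp add: basis_expansion[OF b])
  also have "\<dots> = (\<Sum>j<length es. dual_basis es j x * h (es ! j) (es ! i))"
    by (simp add: linear_sum[OF lin] linear_cmul[OF lin])
  also have "\<dots> = (\<Sum>j<length es. if j = i then dual_basis es i x * h (es ! i) (es ! i) else 0)"
    using es i by (intro sum.cong refl) (auto simp: orthonormal_basis_def)
  also have "\<dots> = dual_basis es i x * h (es ! i) (es ! i)" using i by simp
  finally have "h x (es ! i) = dual_basis es i x * h (es ! i) (es ! i)" .
  moreover have "h (es ! i) (es ! i) \<in> {1, -1}" using es i by (simp add: orthonormal_basis_def)
  ultimately show ?thesis by auto
qed

lemma orthonormal_expansion: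
  assumes h: "is_metric h" and es: "orthonormal_basis h es"
  shows "x = (\<Sum>i<length es. (h (es ! i) (es ! i) * h x (es ! i)) *\<^sub>R es ! i)"
proof -
  have "basis_list es" using es by (simp add: orthonormal_basis_def)
  then have "x = (\<Sum>i<length es. dual_basis es i x *\<^sub>R es ! i)"
    by (simp add: basis_expansion)
  also have "\<dots> = (\<Sum>i<length es. (h (es ! i) (es ! i) * h x (es ! i)) *\<^sub>R es ! i)"
    by (intro sum.cong refl) (simp add: dual_basis_orthonormal[OF h es])
  finally show ?thesis .
qed

lemma contraction_basis_independent:
  assumes h: "is_metric h" and es: "orthonormal_basis h es" and fs: "orthonormal_basis h fs"
    and F: "\<And>y. linear (\<lambda>x. F x y)" "\<And>x. linear (\<lambda>y. F x y)"
  shows "(\<Sum>i<length es. h (es ! i) (es ! i) * F (es ! i) (es ! i)) =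
    (\<Sum>k<length fs. h (fs ! k) (fs ! k) * F (fs ! k) (fs ! k) :: real)"
proof -
  have s: "h x y = h y x" for x y using h by (auto simp: is_metric_def)
  have L: "F x y = (\<Sum>i<length es. (h (es ! i) (es ! i) * h x (es ! i)) * F (es ! i) y)" for x y
    apply (subst orthonormal_expansion[OF h es, of x])
    by (simp add: linear_sum[OF F(1)] linear_cmul[OF F(1)])
  have R: "F x y = (\<Sum>k<length fs. (h (fs ! k) (fs ! k) * h y (fs ! k)) * F x (fs ! k))" for x y
    apply (subst orthonormal_expansion[OF h fs, of y])
    by (simp add: linear_sum[OF F(2)] linear_cmul[OF F(2)])
  have "(\<Sum>i<length es. h (es ! i) (es ! i) * F (es ! i) (es ! i)) =
    (\<Sum>i<length es. \<Sum>k<length fs. h (es ! i) (es ! i) * (h (fs ! k) (fs ! k) *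
      h (es ! i) (fs ! k) * F (es ! i) (fs ! k)))"
    by (subst R) (simp add: sum_distrib_left)
  also have "\<dots> = (\<Sum>k<length fs. \<Sum>i<length es. h (fs ! k) (fs ! k) * (h (es ! i) (es ! i) *
      h (fs ! k) (es ! i) * F (es ! i) (fs ! k)))"
    by (subst sum.swap) (simp add: s mult_ac)
  also have "\<dots> = (\<Sum>k<length fs. h (fs ! k) (fs ! k) * F (fs ! k) (fs ! k))"
    by (subst (2) L) (simp add: sum_distrib_left)
  finally show ?thesis .
qed

lemma lambda2_prod_wrt_symmetric_sum:
  assumes "\<And>x y. \<alpha> x y = - \<alpha> y x" "\<And>x y. \<beta> x y = - \<beta> y x"
  shows "(\<Sum>i<length es. \<Sum>j<length es. h (es ! i) (es ! i) * h (es ! j) (es ! j) *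
      \<alpha> (es ! i) (es ! j) * \<beta> (es ! i) (es ! j)) = 2 * lambda2_prod_wrt es h \<alpha> \<beta>"
proof -
  define G where "G i j = h (es ! i) (es ! i) * h (es ! j) (es ! j) *
      \<alpha> (es ! i) (es ! j) * \<beta> (es ! i) (es ! j)" for i j
  have sym: "G i j = G j i" for i j
    unfolding G_def using assms(1)[of "es ! i" "es ! j"] assms(2)[of "es ! i" "es ! j"] by simp
  have diag: "G i i = 0" for i
    unfolding G_def using assms(1)[of "es ! i" "es ! i"] by simp
  have "(\<Sum>i<n. \<Sum>j<n. G i j) = 2 * (\<Sum>j<n. \<Sum>i<j. G i j)" for n
  proof (induction n)
    case (Suc n)
    have "(\<Sum>i<Suc n. \<Sum>j<Suc n. G i j) =
        (\<Sum>i<n. \<Sum>j<n. G i j) + (\<Sum>i<n. G i n) + (\<Sum>i<n. G n i)"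
      by (simp add: sum.distrib diag)
    moreover have "(\<Sum>i<n. G n i) = (\<Sum>i<n. G i n)"
      by (intro sum.cong refl sym)
    ultimately show ?case using Suc by simp
  qed simp
  then show ?thesis by (simp add: G_def lambda2_prod_wrt_def)
qed

lemma lambda2_prod_basis_independent:
  assumes h: "is_metric h" and es: "orthonormal_basis h es"
    and A: "bilinear \<alpha>" "\<And>x. \<alpha> x x = 0" and B: "bilinear \<beta>" "\<And>x. \<beta> x x = 0"
  shows "lambda2_prod h \<alpha> \<beta> = lambda2_prod_wrt es h \<alpha> \<beta>"
proof -
  define fs where "fs = (SOME fs. orthonormal_basis h fs)"
  have fs: "orthonormal_basis h fs" unfolding fs_def using es by (rule someI)
  have skew: "\<gamma> x y = - \<gamma> y x" if g: "bilinear \<gamma>" "\<And>x. \<gamma> x x = 0"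
    for \<gamma> :: "'a \<Rightarrow> 'a \<Rightarrow> real" and x y
  proof -
    have "\<gamma> (x + y) (x + y) = \<gamma> x x + \<gamma> x y + (\<gamma> y x + \<gamma> y y)"
      by (simp only: bilinear_ladd[OF g(1)] bilinear_radd[OF g(1)] add_ac)
    then show ?thesis by (simp add: g(2))
  qed
  note bl = bilinear_ladd bilinear_radd bilinear_lmul bilinear_rmul
  have "(\<Sum>i<length es. h (es ! i) (es ! i) * (\<Sum>j<length es.
        h (es ! j) (es ! j) * (\<alpha> (es ! i) (es ! j) * \<beta> (es ! i) (es ! j)))) =
      (\<Sum>i<length fs. h (fs ! i) (fs ! i) * (\<Sum>j<length es.
        h (es ! j) (es ! j) * (\<alpha> (fs ! i) (es ! j) * \<beta> (fs ! i) (es ! j))))"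
  proof (rule contraction_basis_independent[OF h es fs,
        of "\<lambda>x y. \<Sum>j<length es. h (es ! j) (es ! j) * (\<alpha> x (es ! j) * \<beta> y (es ! j))"])
    fix y
    show "linear (\<lambda>x. \<Sum>j<length es. h (es ! j) (es ! j) * (\<alpha> x (es ! j) * \<beta> y (es ! j)))"
      by (intro linear_compose_sum ballI linearI) (simp_all add: bl[OF A(1)] algebra_simps)
    show "linear (\<lambda>x. \<Sum>j<length es. h (es ! j) (es ! j) * (\<alpha> y (es ! j) * \<beta> x (es ! j)))"
      by (intro linear_compose_sum ballI linearI) (simp_all add: bl[OF B(1)] algebra_simps)
  qed
  also have "\<dots> = (\<Sum>i<length fs. h (fs ! i) (fs ! i) * (\<Sum>j<length fs.
        h (fs ! j) (fs ! j) * (\<alpha> (fs ! i) (fs ! j) * \<beta> (fs ! i) (fs ! j))))"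
  proof (rule sum.cong[OF refl])
    fix i
    have "(\<Sum>j<length es. h (es ! j) (es ! j) * (\<alpha> (fs ! i) (es ! j) * \<beta> (fs ! i) (es ! j))) =
        (\<Sum>j<length fs. h (fs ! j) (fs ! j) * (\<alpha> (fs ! i) (fs ! j) * \<beta> (fs ! i) (fs ! j)))"
      by (rule contraction_basis_independent[OF h es fs,
            of "\<lambda>x y. \<alpha> (fs ! i) x * \<beta> (fs ! i) y"])
        (auto intro!: linearI simp: bl[OF A(1)] bl[OF B(1)] algebra_simps)
    then show "h (fs ! i) (fs ! i) * (\<Sum>j<length es. h (es ! j) (es ! j) *
          (\<alpha> (fs ! i) (es ! j) * \<beta> (fs ! i) (es ! j))) =
        h (fs ! i) (fs ! i) * (\<Sum>j<length fs. h (fs ! j) (fs ! j) *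
          (\<alpha> (fs ! i) (fs ! j) * \<beta> (fs ! i) (fs ! j)))"
      by (rule arg_cong)
  qed
  finally show ?thesis
    using lambda2_prod_wrt_symmetric_sum[of \<alpha> \<beta> h es, OF skew[OF A] skew[OF B]]
      lambda2_prod_wrt_symmetric_sum[of \<alpha> \<beta> h fs, OF skew[OF A] skew[OF B]]
    by (simp add: lambda2_prod_def fs_def[symmetric] sum_distrib_left mult.assoc)
qed

lemma end_prod_basis_independent:
  assumes h: "is_metric h" and es: "orthonormal_basis h es" and A: "linear A" and B: "linear B"
  shows "end_prod h A B = end_prod_wrt es h A B"
proof -
  define fs where "fs = (SOME fs. orthonormal_basis h fs)"
  have fs: "orthonormal_basis h fs" unfolding fs_def using es by (rule someI)
  have bh: "bilinear h" using h by (simp add: is_metric_def)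
  have hx: "linear (h x)" for x using bh by (simp add: bilinear_def)
  note bl = bilinear_ladd[OF bh] bilinear_radd[OF bh] bilinear_lmul[OF bh] bilinear_rmul[OF bh]
    linear_add[OF A] linear_add[OF B] linear_cmul[OF A] linear_cmul[OF B]
  have eq: "end_prod_wrt gs h A B =
      (\<Sum>i<length gs. h (gs ! i) (gs ! i) * h (A (gs ! i)) (B (gs ! i)))"
    if gs: "orthonormal_basis h gs" for gs
  proof -
    have "(\<Sum>j<length gs. h (gs ! j) (gs ! j) * (dual_basis gs j x * dual_basis gs j y)) = h x y"
      for x y
    proof -
      have "h x y = h x (\<Sum>j<length gs. (h (gs ! j) (gs ! j) * h y (gs ! j)) *\<^sub>R gs ! j)"
        using orthonormal_expansion[OF h gs, of y] by simp
      also have "\<dots> = (\<Sum>j<length gs. h (gs ! j) (gs ! j) * h y (gs ! j) * h x (gs ! j))"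
        by (simp add: linear_sum[OF hx] linear_cmul[OF hx])
      also have "\<dots> = (\<Sum>j<length gs. h (gs ! j) (gs ! j) *
          (dual_basis gs j x * dual_basis gs j y))"
      proof (intro sum.cong refl)
        fix j assume j: "j \<in> {..<length gs}"
        then have "h (gs ! j) (gs ! j) \<in> {1, -1}" using gs by (simp add: orthonormal_basis_def)
        then show "h (gs ! j) (gs ! j) * h y (gs ! j) * h x (gs ! j) =
            h (gs ! j) (gs ! j) * (dual_basis gs j x * dual_basis gs j y)"
          using j by (auto simp: dual_basis_orthonormal[OF h gs])
      qed
      finally show ?thesis ..
    qed
    then show ?thesis
      unfolding end_prod_wrt_def by (simp add: sum_distrib_left[symmetric] mult.assoc)
  qed
  have "(\<Sum>i<length es. h (es ! i) (es ! i) * h (A (es ! i)) (B (es ! i))) =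
      (\<Sum>i<length fs. h (fs ! i) (fs ! i) * h (A (fs ! i)) (B (fs ! i)))"
    by (rule contraction_basis_independent[OF h es fs, of "\<lambda>x y. h (A x) (B y)"])
      (auto intro!: linearI simp: bl)
  then show ?thesis by (simp add: end_prod_def fs_def[symmetric] eq[OF es] eq[OF fs])
qed

end

theory Submission
  imports Defs
begin

text \<open>
  Write \<open>B\<^sub>v x = \<nabla>\<^sub>x v\<close>. Since \<open>\<nabla>\<close> is metric, \<open>tr B\<^sub>v = - tr (ad v)\<close>, which vanishes by
  unimodularity; together with \<open>ad v - \<nabla>\<^sub>v = - B\<^sub>v\<close> this gives \<open>Ric(v, w) = - tr (B\<^sub>w B\<^sub>v)\<close>.
  By the Koszul formula \<open>B\<^sub>v\<close> is the sum of the symmetric part \<open>- (ad v + (ad v)\<^sup>*) / 2\<close> and half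
  of the skew endomorphism corresponding to the 2-form \<open>dv\<^sup>\<flat>\<close>. Symmetric and skew endomorphisms
  are orthogonal for the trace form, and the term \<open>tr (ad w ad v)\<close> is the Killing form.
\<close>

section \<open>Orthonormal bases\<close>

text \<open>\<open>orthonormal_basis\<close> without the spanning condition, so that lists can be
  grown one vector at a time.\<close>

definition orthonormal_list :: "('g::real_vector \<Rightarrow> 'g \<Rightarrow> real) \<Rightarrow> 'g list \<Rightarrow> bool" where
  "orthonormal_list h es \<longleftrightarrow>
    (\<forall>i<length es. h (es ! i) (es ! i) \<in> {1, - 1}) \<and>
    (\<forall>i<length es. \<forall>j<length es. i \<noteq> j \<longrightarrow> h (es ! i) (es ! j) = 0)"

lemma orthonormal_list_distinct:
  assumes "orthonormal_list h es"
  shows "distinct es"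
  unfolding distinct_conv_nth
proof (intro allI impI notI)
  fix i j assume ij: "i < length es" "j < length es" "i \<noteq> j" "es ! i = es ! j"
  then have "h (es ! i) (es ! i) = 0" using assms unfolding orthonormal_list_def by metis
  then show False using assms ij unfolding orthonormal_list_def by force
qed

text \<open>Pairing a vanishing combination with one member of the list isolates its coefficient,
  multiplied by a norm of 1 or -1.\<close>

lemma orthonormal_list_independent:
  assumes h: "bilinear h" and es: "orthonormal_list h es"
  shows "independent (set es)"
proof (rule independent_if_scalars_zero)
  fix u x assume u: "(\<Sum>x\<in>set es. u x *\<^sub>R x) = 0" and x: "x \<in> set es"
  have orth: "h y x = 0" if "y \<in> set es" "y \<noteq> x" for y
    using es x that unfolding orthonormal_list_def in_set_conv_nth by metis
  have lin: "linear (\<lambda>y. h y x)" using h by (simp add: bilinear_def)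
  have "0 = h (\<Sum>y\<in>set es. u y *\<^sub>R y) x" using u linear_0[OF lin] by simp
  also have "\<dots> = (\<Sum>y\<in>set es. u y * h y x)"
    by (simp add: linear_sum[OF lin] linear_cmul[OF lin])
  also have "\<dots> = (\<Sum>y\<in>set es. if y = x then u x * h x x else 0)"
    by (intro sum.cong refl) (auto simp: orth)
  also have "\<dots> = u x * h x x" using x by simp
  finally have "u x * h x x = 0" by simp
  moreover have "h x x \<noteq> 0"
    using es x unfolding orthonormal_list_def in_set_conv_nth by force
  ultimately show "u x = 0" by simp
qed simp

lemma orthonormal_list_snoc:
  assumes h: "is_metric h" and es: "orthonormal_list h es"
    and z: "\<And>i. i < length es \<Longrightarrow> h z (es ! i) = 0" and zz: "h z z \<noteq> 0"
  shows "\<exists>e. orthonormal_list h (es @ [e])"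
proof -
  have bh: "bilinear h" and sym: "h x y = h y x" for x y
    using h by (auto simp: is_metric_def)
  \<comment> \<open>The absolute value lets a vector of negative norm be normalized too;
    \<open>c\<close> squared times \<open>h z z\<close> is then the sign of
    \<open>h z z\<close>.\<close>
  define c where "c = 1 / sqrt \<bar>h z z\<bar>"
  define e where "e = c *\<^sub>R z"
  have "h e e = c\<^sup>2 * h z z"
    by (simp add: e_def bilinear_lmul[OF bh] bilinear_rmul[OF bh] power2_eq_square)
  also have "\<dots> \<in> {1, - 1}"
    using zz by (cases "h z z > 0") (auto simp: c_def power_divide)
  finally have ee: "h e e \<in> {1, - 1}" .
  have "h e (es ! i) = 0" if "i < length es" for i
    using z[OF that] by (simp add: e_def bilinear_lmul[OF bh])
  moreover from this have "h (es ! i) e = 0" if "i < length es" for i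
    using that sym by metis
  ultimately have "orthonormal_list h (es @ [e])"
    using es ee unfolding orthonormal_list_def by (auto simp: nth_append less_Suc_eq)
  then show ?thesis ..
qed

lemma orthogonal_projection:
  assumes h: "is_metric h" and es: "orthonormal_list h es" and j: "j < length es"
  shows "h (x - (\<Sum>i<length es. (h (es ! i) (es ! i) * h x (es ! i)) *\<^sub>R es ! i)) (es ! j) = 0"
proof -
  have bh: "bilinear h" using h by (simp add: is_metric_def)
  then have lin: "linear (\<lambda>y. h y (es ! j))" by (simp add: bilinear_def)
  have one: "h (es ! j) (es ! j) * h (es ! j) (es ! j) = 1"
    using es j unfolding orthonormal_list_def by force
  have "h (\<Sum>i<length es. (h (es ! i) (es ! i) * h x (es ! i)) *\<^sub>R es ! i) (es ! j) =
      (\<Sum>i<length es. h (es ! i) (es ! i) * h x (es ! i) * h (es ! i) (es ! j))"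
    by (simp add: linear_sum[OF lin] linear_cmul[OF lin])
  also have "\<dots> = (\<Sum>i<length es. if i = j then h x (es ! j) else 0)"
    using es j one by (intro sum.cong refl) (auto simp: orthonormal_list_def mult_ac)
  also have "\<dots> = h x (es ! j)" using j by simp
  finally show ?thesis by (simp add: bilinear_lsub[OF bh])
qed

text \<open>In indefinite signature a single vector orthogonal to the list may be null, so
  subtracting a projection is not enough. If no extension existed, every vector orthogonal to the
  list would be null; by polarization \<open>h\<close> would vanish on that complement, and a
  nonzero \<open>x - P x\<close> would be orthogonal to everything.\<close>

lemma orthonormal_list_extend:
  assumes h: "is_metric h" and es: "orthonormal_list h es" and sp: "span (set es) \<noteq> UNIV"
  shows "\<exists>e. orthonormal_list h (es @ [e])"
proof (rule ccontr)
  assume no: "\<nexists>e. orthonormal_list h (es @ [e])"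
  have bh: "bilinear h" and sym: "h x y = h y x" for x y
    using h by (auto simp: is_metric_def)
  define P where "P x = (\<Sum>i<length es. (h (es ! i) (es ! i) * h x (es ! i)) *\<^sub>R es ! i)" for x
  have proj: "h (x - P x) (es ! j) = 0" if "j < length es" for x j
    using orthogonal_projection[OF h es that] by (simp add: P_def)
  have null: "h z z = 0" if "\<And>i. i < length es \<Longrightarrow> h z (es ! i) = 0" for z
    using orthonormal_list_snoc[OF h es that] no by blast
  obtain x where x: "x \<notin> span (set es)" using sp by blast
  have "P x \<in> span (set es)"
    unfolding P_def by (intro span_sum span_scale span_base) simp
  then have ne: "x - P x \<noteq> 0" using x by auto
  have "h (x - P x) u = 0" for u
  proof -
    \<comment> \<open>Polarization: two vectors of the complement and their sum are all null, hence
      their product is zero.\<close>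
    have "h (x - P x + (u - P u)) (x - P x + (u - P u)) = 0"
      by (rule null) (simp only: bilinear_ladd[OF bh] proj add_0)
    moreover have "h (x - P x) (x - P x) = 0" "h (u - P u) (u - P u) = 0"
      by (rule null, rule proj, assumption)+
    ultimately have "h (x - P x) (u - P u) = 0"
      using sym[of "u - P u" "x - P x"]
      by (simp only: bilinear_ladd[OF bh] bilinear_radd[OF bh])
    moreover have lin: "linear (h (x - P x))" using bh by (simp add: bilinear_def)
    have "h (x - P x) (P u) = 0"
      unfolding P_def[of u] using proj[of _ x]
      by (simp add: linear_sum[OF lin] linear_cmul[OF lin])
    ultimately show ?thesis by (simp add: bilinear_rsub[OF bh])
  qed
  then show False using ne h unfolding is_metric_def by blast
qed

text \<open>Independence bounds the length of orthonormal lists by the size of a finite spanning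
  set. One of maximal length cannot be extended, so it spans.\<close>

lemma orthonormal_basis_exists:
  fixes h :: "'g::real_vector \<Rightarrow> 'g \<Rightarrow> real"
  assumes fd: "finite_dim TYPE('g)" and h: "is_metric h"
  shows "\<exists>es. orthonormal_basis h es"
proof -
  obtain B :: "'g set" where B: "finite B" "span B = UNIV"
    using fd unfolding finite_dim_def by blast
  have bh: "bilinear h" using h by (simp add: is_metric_def)
  have bound: "length es < Suc (card B)" if "orthonormal_list h es" for es
    using independent_span_bound[OF B(1) orthonormal_list_independent[OF bh that]]
      distinct_card[OF orthonormal_list_distinct[OF that]] B(2) by simp
  have "\<exists>es. orthonormal_list h es \<and> (\<forall>fs. orthonormal_list h fs \<longrightarrow> length fs \<le> length es)"
  proof (rule ex_has_greatest_nat)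
    show "orthonormal_list h []" by (simp add: orthonormal_list_def)
    show "\<forall>fs. orthonormal_list h fs \<longrightarrow> length fs < Suc (card B)" using bound by blast
  qed
  then obtain es where es: "orthonormal_list h es"
    and max: "\<And>fs. orthonormal_list h fs \<Longrightarrow> length fs \<le> length es" by blast
  have "span (set es) = UNIV"
    using orthonormal_list_extend[OF h es] max by fastforce
  then have "basis_list es"
    using orthonormal_list_distinct[OF es] orthonormal_list_independent[OF bh es]
    by (simp add: basis_list_def)
  then show ?thesis
    using es unfolding orthonormal_basis_def orthonormal_list_def by blast
qed


section \<open>The Levi-Civita connection\<close>

lemma is_metric_cancel:
  assumes h: "is_metric h" and eq: "\<And>z. h x z = h y z"
  shows "x = y"
proof -
  have "bilinear h" using h by (simp add: is_metric_def)
  then have "h (x - y) z = 0" for z by (simp add: bilinear_lsub eq)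
  then show ?thesis using h unfolding is_metric_def by fastforce
qed

lemma lie_bracket_skew:
  assumes "lie_bracket br"
  shows "br x y = - br y x"
proof -
  have b: "bilinear br" and alt: "\<And>x. br x x = 0" using assms by (auto simp: lie_bracket_def)
  have "br (x + y) (x + y) = br x x + br x y + (br y x + br y y)"
    by (simp only: bilinear_ladd[OF b] bilinear_radd[OF b] add_ac)
  then have "br x y + br y x = 0" by (simp add: alt)
  then show ?thesis by (simp add: eq_neg_iff_add_eq_0)
qed

text \<open>Vanishing torsion turns the three brackets into six connection terms. Since each
  \<open>D x\<close> is skew for \<open>h\<close>, four of them cancel in pairs and the other two
  agree.\<close>

lemma koszul:
  assumes h: "is_metric h" and D: "is_levi_civita br h D"
  shows "2 * h (D x y) z = h (br x y) z - h (br y z) x + h (br z x) y"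
proof -
  have bh: "bilinear h" and sym: "\<And>x y. h x y = h y x" using h by (auto simp: is_metric_def)
  have tor: "h (br x y) z = h (D x y) z - h (D y x) z" for x y z
    using D bilinear_lsub[OF bh] unfolding is_levi_civita_def by metis
  have met: "h (D x y) z = - h (D x z) y" for x y z
    using D sym[of y "D x z"] unfolding is_levi_civita_def by (metis add_eq_0_iff2)
  show ?thesis
    unfolding tor using met[of x y z] met[of y x z] met[of z x y] by simp
qed

text \<open>An explicit vector representing a linear form; the factor
  \<open>h (es ! i) (es ! i)\<close> corrects the sign in negative directions.\<close>

lemma riesz_representation:
  assumes h: "is_metric h" and es: "orthonormal_basis h es" and f: "linear f"
  shows "h (\<Sum>i<length es. (h (es ! i) (es ! i) * f (es ! i)) *\<^sub>R es ! i) z = f z"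
proof -
  have bh: "bilinear h" and sym: "\<And>x y. h x y = h y x" using h by (auto simp: is_metric_def)
  have lin: "linear (\<lambda>y. h y z)" using bh by (simp add: bilinear_def)
  have "f z = f (\<Sum>i<length es. (h (es ! i) (es ! i) * h z (es ! i)) *\<^sub>R es ! i)"
    using orthonormal_expansion[OF h es, of z] by simp
  then show ?thesis
    by (simp add: linear_sum[OF lin] linear_cmul[OF lin] linear_sum[OF f] linear_cmul[OF f]
        sym[of z] mult_ac)
qed

text \<open>The Koszul formula is read as a definition: its right-hand side is linear in
  \<open>z\<close> and so is represented by a vector \<open>D x y\<close>. The axioms are then
  checked by pairing with arbitrary vectors.\<close>

lemma levi_civita_exists:
  fixes br :: "'g::real_vector \<Rightarrow> 'g \<Rightarrow> 'g"
  assumes fd: "finite_dim TYPE('g)" and br: "lie_bracket br" and h: "is_metric h"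
  shows "\<exists>D. is_levi_civita br h D"
proof -
  obtain es where es: "orthonormal_basis h es" using orthonormal_basis_exists[OF fd h] ..
  have bh: "bilinear h" and sym: "\<And>x y. h x y = h y x" using h by (auto simp: is_metric_def)
  have bb: "bilinear br" using br by (simp add: lie_bracket_def)
  note bl = bilinear_ladd[OF bh] bilinear_radd[OF bh] bilinear_lmul[OF bh] bilinear_rmul[OF bh]
    bilinear_ladd[OF bb] bilinear_radd[OF bb] bilinear_lmul[OF bb] bilinear_rmul[OF bb]
  have skew: "h (br x y) z = - h (br y x) z" for x y z
    by (subst lie_bracket_skew[OF br]) (rule bilinear_lneg[OF bh])
  define K where "K x y z = (h (br x y) z - h (br y z) x + h (br z x) y) / 2" for x y z
  define D where "D x y = (\<Sum>i<length es. (h (es ! i) (es ! i) * K x y (es ! i)) *\<^sub>R es ! i)" for x y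
  have "linear (K x y)" for x y
    by (rule linearI) (simp_all add: K_def bl algebra_simps add_divide_distrib diff_divide_distrib)
  then have hD: "h (D x y) z = K x y z" for x y z
    unfolding D_def by (rule riesz_representation[OF h es])
  have "linear (D x)" for x
    by (rule linearI; rule is_metric_cancel[OF h])
      (simp_all add: bl hD K_def algebra_simps add_divide_distrib diff_divide_distrib)
  moreover have "linear (\<lambda>x. D x y)" for y
    by (rule linearI; rule is_metric_cancel[OF h])
      (simp_all add: bl hD K_def algebra_simps add_divide_distrib diff_divide_distrib)
  ultimately have "bilinear D" by (simp add: bilinear_def)
  moreover have "D x y - D y x = br x y" for x y
  proof (rule is_metric_cancel[OF h])
    fix z
    show "h (D x y - D y x) z = h (br x y) z"
      using skew[of x y z] skew[of y z x] skew[of z x y]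
      by (simp add: bilinear_lsub[OF bh] hD K_def field_simps)
  qed
  moreover have "h (D x y) z + h y (D x z) = 0" for x y z
    using skew[of x y z] skew[of y z x] skew[of z x y]
    by (simp add: sym[of y] hD K_def field_simps)
  ultimately have "is_levi_civita br h D" by (simp add: is_levi_civita_def)
  then show ?thesis by (rule exI[of _ D])
qed

text \<open>\<open>levi_civita\<close> is a definite description, so uniqueness is required as well;
  it follows because the Koszul formula determines \<open>h (D x y) z\<close>.\<close>

lemma levi_civita_correct:
  fixes br :: "'g::real_vector \<Rightarrow> 'g \<Rightarrow> 'g"
  assumes fd: "finite_dim TYPE('g)" and br: "lie_bracket br" and h: "is_metric h"
  shows "is_levi_civita br h (levi_civita br h)"
proof -
  obtain D where D: "is_levi_civita br h D" using levi_civita_exists[OF assms] ..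
  have "E = D" if E: "is_levi_civita br h E" for E
  proof (intro ext, rule is_metric_cancel[OF h])
    fix x y z
    show "h (E x y) z = h (D x y) z" using koszul[OF h E, of x y z] koszul[OF h D, of x y z] by simp
  qed
  with D have "\<exists>!D. is_levi_civita br h D" by blast
  then show ?thesis unfolding levi_civita_def by (rule theI')
qed


section \<open>Traces in an orthonormal basis\<close>

lemma lin_trace_orthonormal:
  assumes h: "is_metric h" and es: "orthonormal_basis h es" and f: "linear f"
  shows "lin_trace f = (\<Sum>i<length es. h (es ! i) (es ! i) * h (f (es ! i)) (es ! i))"
proof -
  have "basis_list es" using es by (simp add: orthonormal_basis_def)
  then show ?thesis by (simp add: lin_trace_eq[OF f] dual_basis_orthonormal[OF h es])
qed

text \<open>Expanding \<open>g (es ! i)\<close> in the basis puts the trace form into the same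
  double-sum shape as the two induced scalar products, up to a transposition of indices.\<close>

lemma lin_trace_comp:
  assumes h: "is_metric h" and es: "orthonormal_basis h es" and f: "linear f" and g: "linear g"
  shows "lin_trace (f \<circ> g) = (\<Sum>i<length es. \<Sum>j<length es.
    h (es ! i) (es ! i) * h (es ! j) (es ! j) * h (g (es ! i)) (es ! j) * h (f (es ! j)) (es ! i))"
proof -
  have "linear (\<lambda>x. h x y)" for y using h by (simp add: is_metric_def bilinear_def)
  from linear_compose[OF f this] have lin: "linear (\<lambda>x. h (f x) y)" for y by (simp add: o_def)
  have "h (f x) y = (\<Sum>j<length es. h (es ! j) (es ! j) * h x (es ! j) * h (f (es ! j)) y)" for x y
    by (subst orthonormal_expansion[OF h es, of x])
      (simp add: linear_sum[OF lin] linear_cmul[OF lin])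
  from this[of "g _"] show ?thesis
    by (simp add: lin_trace_orthonormal[OF h es linear_compose[OF g f]] sum_distrib_left mult_ac)
qed

text \<open>Passing from dual coordinates to products with \<open>es ! j\<close> costs one sign for
  each of the two factors, and these signs multiply to 1.\<close>

lemma end_prod_orthonormal:
  assumes h: "is_metric h" and es: "orthonormal_basis h es" and A: "linear A" and B: "linear B"
  shows "end_prod h A B = (\<Sum>i<length es. \<Sum>j<length es.
    h (es ! i) (es ! i) * h (es ! j) (es ! j) * h (A (es ! i)) (es ! j) * h (B (es ! i)) (es ! j))"
  unfolding end_prod_basis_independent[OF assms] end_prod_wrt_def
proof (intro sum.cong refl)
  fix i j assume "j \<in> {..<length es}"
  then have j: "j < length es" by simp
  then have "h (es ! j) (es ! j) \<in> {1, - 1}" using es by (simp add: orthonormal_basis_def)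
  then show "h (es ! i) (es ! i) * h (es ! j) (es ! j) * dual_basis es j (A (es ! i)) *
      dual_basis es j (B (es ! i)) =
    h (es ! i) (es ! i) * h (es ! j) (es ! j) * h (A (es ! i)) (es ! j) * h (B (es ! i)) (es ! j)"
    by (auto simp: dual_basis_orthonormal[OF h es j])
qed

lemma lin_trace_add:
  fixes f g :: "'g::real_vector \<Rightarrow> 'g" and es :: "'g list"
  assumes "basis_list es" "linear f" "linear g"
  shows "lin_trace (\<lambda>x. f x + g x) = lin_trace f + lin_trace g"
  using assms
  by (simp add: lin_trace_eq linear_compose_add linear_add[OF linear_dual_basis] sum.distrib)

lemma lin_trace_diff:
  fixes f g :: "'g::real_vector \<Rightarrow> 'g" and es :: "'g list"
  assumes "basis_list es" "linear f" "linear g"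
  shows "lin_trace (\<lambda>x. f x - g x) = lin_trace f - lin_trace g"
  using assms
  by (simp add: lin_trace_eq linear_compose_sub linear_diff[OF linear_dual_basis] sum_subtractf)

lemma lin_trace_comp_commute:
  fixes f g :: "'g::real_vector \<Rightarrow> 'g" and h :: "'g \<Rightarrow> 'g \<Rightarrow> real"
  assumes h: "is_metric h" and es: "orthonormal_basis h es" and f: "linear f" and g: "linear g"
  shows "lin_trace (f \<circ> g) = lin_trace (g \<circ> f)"
  unfolding lin_trace_comp[OF h es f g] lin_trace_comp[OF h es g f]
  by (subst sum.swap) (simp add: mult_ac)

text \<open>A sum over a square of indices sees only the symmetric part of the summand. This makes
  products of a symmetric and a skew matrix drop out.\<close>

lemma sum_eq_of_symmetrization_eq:
  fixes f g :: "nat \<Rightarrow> nat \<Rightarrow> real"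
  assumes "\<And>i j. f i j + f j i = g i j + g j i"
  shows "(\<Sum>i<n. \<Sum>j<n. f i j) = (\<Sum>i<n. \<Sum>j<n. g i j)"
proof -
  have "(\<Sum>i<n. \<Sum>j<n. k i j + k j i) = 2 * (\<Sum>i<n. \<Sum>j<n. k i j)" for k :: "nat \<Rightarrow> nat \<Rightarrow> real"
    using sum.swap[of "\<lambda>i j. k j i" "{..<n}" "{..<n}"] by (simp add: sum.distrib)
  from this[of f] this[of g] show ?thesis by (simp add: assms)
qed


section \<open>The Ricci tensor\<close>

text \<open>The traces are opposite entry by entry on the diagonal: in the Koszul formula with equal
  outer arguments the term with \<open>br x x\<close> vanishes and the other two coincide.\<close>

lemma lin_trace_nabla:
  fixes br :: "'g::real_vector \<Rightarrow> 'g \<Rightarrow> 'g"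
  assumes fd: "finite_dim TYPE('g)" and br: "lie_bracket br" and h: "is_metric h"
    and D: "is_levi_civita br h D"
  shows "lin_trace (\<lambda>x. D x z) = - lin_trace (ad br z)"
proof -
  obtain es where es: "orthonormal_basis h es" using orthonormal_basis_exists[OF fd h] ..
  have bb: "bilinear br" using br by (simp add: lie_bracket_def)
  have bh: "bilinear h" using h by (simp add: is_metric_def)
  have l1: "linear (\<lambda>x. D x z)" using D by (simp add: is_levi_civita_def bilinear_def)
  have l2: "linear (ad br z)" using bb by (simp add: ad_def bilinear_def)
  have alt: "br x x = 0" for x using br by (simp add: lie_bracket_def)
  have "h (D x z) x = - h (br z x) x" for x
    using koszul[OF h D, of x z x] bilinear_lneg[OF bh, of "br z x" x]
    by (simp add: lie_bracket_skew[OF br, of x z] alt bilinear_lzero[OF bh])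
  then show ?thesis
    unfolding lin_trace_orthonormal[OF h es l1] lin_trace_orthonormal[OF h es l2]
    by (simp add: ad_def sum_negf)
qed

text \<open>Substituting \<open>D x v - D v x\<close> for \<open>br x v\<close> in the curvature
  gives four traces. The middle two cancel by cyclicity and the first vanishes by
  unimodularity.\<close>

lemma Ric_unimodular:
  fixes br :: "'g::real_vector \<Rightarrow> 'g \<Rightarrow> 'g"
  assumes fd: "finite_dim TYPE('g)" and br: "lie_bracket br" and h: "is_metric h"
    and uni: "unimodular br" and D: "D = levi_civita br h"
  shows "Ric br h v w = - lin_trace ((\<lambda>x. D x w) \<circ> (\<lambda>x. D x v))"
proof -
  obtain es where es: "orthonormal_basis h es" using orthonormal_basis_exists[OF fd h] ..
  then have bes: "basis_list es" by (simp add: orthonormal_basis_def)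
  have lc: "is_levi_civita br h D" unfolding D by (rule levi_civita_correct[OF fd br h])
  have l1: "linear (D x)" and l2: "linear (\<lambda>y. D y x)" for x
    using lc by (auto simp: is_levi_civita_def bilinear_def)
  have tor: "br x v = D x v - D v x" for x using lc by (simp add: is_levi_civita_def)
  have c1: "linear (\<lambda>x. D v (D x w))" using linear_compose[OF l2 l1] by (simp add: o_def)
  have c2: "linear (\<lambda>x. D (D v x) w)" using linear_compose[OF l1 l2] by (simp add: o_def)
  have c3: "linear (\<lambda>x. D (D x v) w)" using linear_compose[OF l2 l2] by (simp add: o_def)
  have "Ric br h v w =
      lin_trace (\<lambda>x. (D x (D v w) - D v (D x w) + D (D v x) w) - D (D x v) w)"
    unfolding Ric_def curvature_def Let_def D[symmetric] tor
    by (simp add: linear_diff[OF l2] algebra_simps)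
  also have "\<dots> = lin_trace (\<lambda>x. D x (D v w)) - lin_trace (\<lambda>x. D v (D x w))
      + lin_trace (\<lambda>x. D (D v x) w) - lin_trace (\<lambda>x. D (D x v) w)"
    by (simp add: lin_trace_add[OF bes] lin_trace_diff[OF bes] linear_compose_add
        linear_compose_sub l2 c1 c2 c3)
  also have "lin_trace (\<lambda>x. D v (D x w)) = lin_trace (\<lambda>x. D (D v x) w)"
    using lin_trace_comp_commute[OF h es l1 l2, of v w] by (simp add: o_def)
  also have "lin_trace (\<lambda>x. D x (D v w)) = 0"
    using uni by (simp add: lin_trace_nabla[OF fd br h lc] unimodular_def)
  finally show ?thesis by (simp add: o_def)
qed

theorem proposition2p1:
  fixes br :: "'g::real_vector \<Rightarrow> 'g \<Rightarrow> 'g"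
    and h :: "'g \<Rightarrow> 'g \<Rightarrow> real"
  assumes "finite_dim TYPE('g)"
    and "lie_bracket br"
    and "unimodular br"
    and "\<forall>x y. killing_form br x y = 0"
    and "is_metric h"
  shows "\<forall>v w. Ric br h v w =
    1/2 * lambda2_prod h (ce_differential br (flat h v)) (ce_differential br (flat h w))
    - 1/2 * end_prod h (ad br v) (ad br w)"
proof (intro allI)
  fix v w
  note fd = assms(1) and br = assms(2) and uni = assms(3) and kf = assms(4) and h = assms(5)
  obtain es where es: "orthonormal_basis h es" using orthonormal_basis_exists[OF fd h] ..
  define D where "D = levi_civita br h"
  have lc: "is_levi_civita br h D" unfolding D_def by (rule levi_civita_correct[OF fd br h])
  have l2: "linear (\<lambda>y. D y x)" for x
    using lc by (auto simp: is_levi_civita_def bilinear_def)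
  have bh: "bilinear h" and sym: "\<And>x y. h x y = h y x" using h by (auto simp: is_metric_def)
  have bb: "bilinear br" using br by (simp add: lie_bracket_def)
  have lad: "linear (ad br x)" for x using bb by (simp add: ad_def bilinear_def)
  \<comment> \<open>\<open>c\<close> collects the signs, \<open>a u\<close> is the matrix of
    \<open>ad br u\<close> with its output index lowered, and \<open>b u\<close> below holds the
    components of the 2-form \<open>k u\<close>.\<close>
  define c where "c i j = h (es ! i) (es ! i) * h (es ! j) (es ! j)" for i j
  define a where "a u i j = h (br u (es ! i)) (es ! j)" for u i j
  define k where "k u = ce_differential br (flat h u)" for u
  define b where "b u i j = k u (es ! i) (es ! j)" for u i j
  have cc: "c i j = c j i" for i j by (simp add: c_def)
  have kdef: "k u x y = - h u (br x y)" for u x y by (simp add: k_def ce_differential_def flat_def)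
  have kskew: "k u x y = - k u y x" for u x y
    by (simp add: kdef lie_bracket_skew[OF br, of x y] bilinear_rneg[OF bh])
  have kalt: "k u x x = 0" for u x using kskew[of u x x] by simp
  have kbil: "bilinear (k u)" for u
    unfolding bilinear_def
    by (auto intro!: linearI simp: kdef bilinear_ladd[OF bb] bilinear_radd[OF bb]
        bilinear_lmul[OF bb] bilinear_rmul[OF bb] bilinear_radd[OF bh] bilinear_rmul[OF bh])
  have bskew: "b u j i = - b u i j" for u i j unfolding b_def by (rule kskew)
  \<comment> \<open>Koszul splits the matrix of the covariant derivative of \<open>u\<close> into a
    skew part from \<open>b\<close> and a symmetric part from \<open>a\<close>.\<close>
  have B: "h (D (es ! i) u) (es ! j) = (b u i j - a u i j - a u j i) / 2" for u i j
    using koszul[OF h lc, of "es ! i" u "es ! j"]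
    unfolding lie_bracket_skew[OF br, of "es ! i" u] lie_bracket_skew[OF br, of "es ! j" "es ! i"]
    by (simp add: a_def b_def kdef sym[of u] bilinear_lneg[OF bh])
  \<comment> \<open>The arguments are taken in the order \<open>w\<close>, \<open>v\<close> to match
    the composition in \<open>Ric_unimodular\<close>.\<close>
  have "killing_form br w v = (\<Sum>i<length es. \<Sum>j<length es. c i j * a v i j * a w j i)"
    unfolding killing_form_def lin_trace_comp[OF h es lad lad] by (simp add: ad_def c_def a_def)
  then have K: "(\<Sum>i<length es. \<Sum>j<length es. c i j * a v i j * a w j i) = 0"
    using kf by simp
  \<comment> \<open>The factor 2 arises because the full double sum counts each pair of distinct
    indices twice.\<close>
  have L: "(\<Sum>i<length es. \<Sum>j<length es. c i j * b v i j * b w i j) =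
      2 * lambda2_prod h (k v) (k w)"
    unfolding lambda2_prod_basis_independent[OF h es kbil kalt kbil kalt]
      lambda2_prod_wrt_symmetric_sum[OF kskew kskew, symmetric] c_def b_def ..
  have E: "(\<Sum>i<length es. \<Sum>j<length es. c i j * a v i j * a w i j) =
      end_prod h (ad br v) (ad br w)"
    unfolding end_prod_orthonormal[OF h es lad lad] by (simp add: ad_def c_def a_def)
  have "lin_trace ((\<lambda>x. D x w) \<circ> (\<lambda>x. D x v)) =
      (\<Sum>i<length es. \<Sum>j<length es.
        c i j * ((b v i j - a v i j - a v j i) / 2) * ((b w j i - a w j i - a w i j) / 2))"
    unfolding lin_trace_comp[OF h es l2 l2] B c_def ..
  \<comment> \<open>The two summands agree only after adding their transposes, which kills the mixed
    products of \<open>a\<close> and \<open>b\<close>. The minus sign before the \<open>b\<close>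
    product comes from \<open>b w j i = - b w i j\<close>.\<close>
  also have "\<dots> = (\<Sum>i<length es. \<Sum>j<length es. c i j * a v i j * a w i j / 2
      + c i j * a v i j * a w j i / 2 - c i j * b v i j * b w i j / 4)"
  proof (rule sum_eq_of_symmetrization_eq)
    fix i j
    show "c i j * ((b v i j - a v i j - a v j i) / 2) * ((b w j i - a w j i - a w i j) / 2) +
        c j i * ((b v j i - a v j i - a v i j) / 2) * ((b w i j - a w i j - a w j i) / 2) =
      c i j * a v i j * a w i j / 2 + c i j * a v i j * a w j i / 2
        - c i j * b v i j * b w i j / 4 +
      (c j i * a v j i * a w j i / 2 + c j i * a v j i * a w i j / 2
        - c j i * b v j i * b w j i / 4)"
      unfolding cc[of j i] bskew[of _ j i] by (simp add: field_simps)
  qed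
  also have "\<dots> = end_prod h (ad br v) (ad br w) / 2 - lambda2_prod h (k v) (k w) / 2"
    by (simp add: sum.distrib sum_subtractf sum_divide_distrib[symmetric] K L E)
  finally show "Ric br h v w =
      1/2 * lambda2_prod h (ce_differential br (flat h v)) (ce_differential br (flat h w))
      - 1/2 * end_prod h (ad br v) (ad br w)"
    unfolding Ric_unimodular[OF fd br h uni D_def] k_def by simp
qed

end
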